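(* Let $N=2$, $K=2$, let $\alpha,p_1,p_2,\beta\in(0,1)$, $\beta_1=\beta_2=\beta$, and let $a_1,a_2\ge 0$ with $a_1+a_2=1$. Let $P(x_1,x_2)$ be the stationary probabilities of the states $(x_1,x_2)\in\{0,1,2\}^2$ of the system $S$ with these parameters, and let $P^*(x_1^*,x_2^* )$ be the stationary probabilities of the states $(x_1^*,x_2^* )\in\{0,1\}^2$ of the associated one-type system $S^*$. Then for all $x_1^*,x_2^*\in\{0,1\}$, the sum of the stationary probabilities of the states of $S$ belonging to the set $G(x_1^*,x_2^* )$ equals the stationary probability that $S^*$ is in the state $(x_1^*,x_2^* )$: $$\sum_{(x_1,x_2)\in G(x_1^*,x_2^* )}P(x_1,x_2)=P^*(x_1^*,x_2^* ).$$
   Context: System $S$ (synchronous exclusion process with two particle types on an open lattice of two cells). The cells are $1$ and $2$, each containing at most one particle, and each particle is of type $1$ or $2$. A state is $(x_1,x_2)\in\{0,1,2\}^2$, where $x_i=0$ means cell $i$ is vacant and $x_i=k>0$ means cell $i$ contains a particle of type $k$. Time is discrete. Given the state at time $t$, all of the following random events are mutually independent, occur simultaneously, depend only on the configuration at time $t$, and determine the state at time $t+1$ (a finite Markov chain): (i) if cell $1$ is vacant at time $t$, then with probability $\alpha$ a particle arrives from outside and is in cell $1$ at time $t+1$; it is of type $k$ with probability $a_k$; (ii) if at time $t$ cell $1$ contains a particle of type $k$ and cell $2$ is vacant, then with probability $p_k$ this particle is in cell $2$ at time $t+1$ (and cell $1$ is then vacant), otherwise it stays; (iii) if at time $t$ cell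 $2$ contains a particle of type $k$, then with probability $\beta_k$ it leaves the system and cell $2$ is vacant at time $t+1$, otherwise it stays. A particle in cell $1$ stays there if cell $2$ is occupied at time $t$. System $S^*$: the same process with the same $N=2$ and $\alpha$, but with a single type of particles, whose movement probability (from cell $1$ to a vacant cell $2$) is $p^*=\left(\frac{a_1}{p_1}+\frac{a_2}{p_2}\right)^{-1}$ and whose exit probability from cell $2$ is $\beta^*=\left(\frac{a_1}{\beta_1}+\frac{a_2}{\beta_2}\right)^{-1}$ (which equals $\beta$ when $\beta_1=\beta_2=\beta$). Its states are $(x_1^*,x_2^* )\in\{0,1\}^2$ with $x_i^*=0$ if cell $i$ is vacant and $x_i^*=1$ if it is occupied. Let $\eta(0)=0$ and $\eta(k)=1$ for $k>0$. For $(x_1^*,x_2^* )\in\{0,1\}^2$, $G(x_1^*,x_2^* )$ is the set of states $(x_1,x_2)$ of $S$ with $(\eta(x_1),\eta(x_2))=(x_1^*,x_2^* )$. The stationary probability of a state is the limit of the probability that the system is in this state as $t\to\infty$ (it exists and is independent of the initial state; equivalently, it is given by the unique stationary distribution of the Markov chain). *)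

theory Defs
  imports "HOL-Probability.Probability"
begin

text \<open>
  A state is a pair of cell contents: \<open>0\<close> is a vacant cell and \<open>k > 0\<close> a particle of type \<open>k\<close>.
  The values of \<open>p\<close> and \<open>\<beta>\<close> at \<open>0\<close> and the draws that are irrelevant in the
  current configuration do not influence the result.
\<close>

definition exclusion_step ::
    "real \<Rightarrow> nat pmf \<Rightarrow> (nat \<Rightarrow> real) \<Rightarrow> (nat \<Rightarrow> real) \<Rightarrow> nat \<times> nat \<Rightarrow> (nat \<times> nat) pmf" where
  "exclusion_step \<alpha> A p \<beta> = (\<lambda>(x1, x2).
     bind_pmf (bernoulli_pmf \<alpha>) (\<lambda>arrives.
     bind_pmf A (\<lambda>k.
     bind_pmf (bernoulli_pmf (p x1)) (\<lambda>moves.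
     bind_pmf (bernoulli_pmf (\<beta> x2)) (\<lambda>leaves.
     return_pmf
       (if x1 = 0 then (if arrives then k else 0)
        else if x2 = 0 \<and> moves then 0 else x1,
        if x2 = 0 then (if x1 \<noteq> 0 \<and> moves then x1 else 0)
        else if leaves then 0 else x2))))))"

text \<open>For \<open>a 1, a 2 \<ge> 0\<close> with \<open>a 1 + a 2 = 1\<close>, type \<open>k \<in> {1, 2}\<close> has probability \<open>a k\<close>.\<close>

definition type_pmf :: "(nat \<Rightarrow> real) \<Rightarrow> nat pmf" where
  "type_pmf a = map_pmf (\<lambda>b. if b then 1 else 2) (bernoulli_pmf (a 1))"

definition S_step ::
    "real \<Rightarrow> (nat \<Rightarrow> real) \<Rightarrow> (nat \<Rightarrow> real) \<Rightarrow> (nat \<Rightarrow> real) \<Rightarrow> nat \<times> nat \<Rightarrow> (nat \<times> nat) pmf" where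
  "S_step \<alpha> a p \<beta> = exclusion_step \<alpha> (type_pmf a) p \<beta>"

definition S_states :: "(nat \<times> nat) set" where
  "S_states = {0, 1, 2} \<times> {0, 1, 2}"

text \<open>Used both for the movement and for the exit probability of the one-type system.\<close>

definition star_prob :: "(nat \<Rightarrow> real) \<Rightarrow> (nat \<Rightarrow> real) \<Rightarrow> real" where
  "star_prob a q = inverse (a 1 / q 1 + a 2 / q 2)"

definition Sstar_step ::
    "real \<Rightarrow> (nat \<Rightarrow> real) \<Rightarrow> (nat \<Rightarrow> real) \<Rightarrow> (nat \<Rightarrow> real) \<Rightarrow> nat \<times> nat \<Rightarrow> (nat \<times> nat) pmf" where
  "Sstar_step \<alpha> a p \<beta> =
     exclusion_step \<alpha> (return_pmf 1) (\<lambda>_. star_prob a p) (\<lambda>_. star_prob a \<beta>)"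

definition Sstar_states :: "(nat \<times> nat) set" where
  "Sstar_states = {0, 1} \<times> {0, 1}"

primrec state_at :: "('s \<Rightarrow> 's pmf) \<Rightarrow> 's \<Rightarrow> nat \<Rightarrow> 's pmf" where
  "state_at M s0 0 = return_pmf s0"
| "state_at M s0 (Suc t) = bind_pmf (state_at M s0 t) M"

text \<open>
  The limit has to be the same for all initial states in \<open>X\<close>; if there is no such common limit,
  the value is unspecified.
\<close>

definition stationary_prob :: "('s \<Rightarrow> 's pmf) \<Rightarrow> 's set \<Rightarrow> 's \<Rightarrow> real" where
  "stationary_prob M X s =
     (THE L. \<forall>s0\<in>X. (\<lambda>t. pmf (state_at M s0 t) s) \<longlonglongrightarrow> L)"

definition eta :: "nat \<Rightarrow> nat" where
  "eta k = (if k = 0 then 0 else 1)"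

definition G :: "nat \<Rightarrow> nat \<Rightarrow> (nat \<times> nat) set" where
  "G y1 y2 = {(x1, x2) \<in> S_states. eta x1 = y1 \<and> eta x2 = y2}"

end

theory Submission imports Defs begin

text \<open>
  Both systems are instances of one exclusion process with an arbitrary finite set of types.
  From every state the empty state can be reached in exactly three steps, so the chain forgets its
  initial state (Doeblin) and any nonnegative solution of the balance equations gives, after
  normalisation, the stationary probabilities. With a common exit probability the balance
  equations have an explicit solution in which \<open>p\<close> occurs only in the weights
  \<open>pmf A k / p k\<close> of the states \<open>(k, 0)\<close>; their sum over \<open>k\<close> is the reciprocal of \<open>p*\<close>,
  which is the weight of the state \<open>(1, 0)\<close> in the one-type system.
\<close>

section \<open>Convergence of finite Markov chains\<close>

text \<open>Chapman-Kolmogorov, conditioning on the state after the first \<open>n\<close> steps,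
  whereas the recursion of \<open>state_at\<close> splits off the last step.\<close>

lemma state_at_add:
  "state_at M s (t + n) = bind_pmf (state_at M s n) (\<lambda>x. state_at M x t)"
  by (induction t) (simp_all add: bind_return_pmf' bind_assoc_pmf)

lemma set_state_at_subset:
  assumes "\<And>x. x \<in> X \<Longrightarrow> set_pmf (M x) \<subseteq> X" and "s \<in> X"
  shows "set_pmf (state_at M s t) \<subseteq> X"
  using assms by (induction t) auto

lemma pmf_bind_finite_sum:
  assumes "finite X" "set_pmf N \<subseteq> X"
  shows "pmf (bind_pmf N f) y = (\<Sum>x\<in>X. pmf N x * pmf (f x) y)"
  unfolding pmf_bind using assms by (subst integral_measure_pmf[of X]) auto

lemma finite_sum_ge_member:
  fixes c g :: "'a \<Rightarrow> real"
  assumes "finite X" "z \<in> X" "\<And>x. x \<in> X \<Longrightarrow> 0 \<le> c x" "\<And>x. x \<in> X \<Longrightarrow> 0 \<le> g x"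
    and "\<delta> \<le> c z"
  shows "\<delta> * g z \<le> (\<Sum>x\<in>X. c x * g x)"
proof -
  have "\<delta> * g z \<le> c z * g z"
    using assms by (intro mult_right_mono) auto
  also have "\<dots> \<le> (\<Sum>x\<in>X. c x * g x)"
    using assms by (intro member_le_sum) auto
  finally show ?thesis .
qed

locale doeblin_chain =
  fixes M :: "'s \<Rightarrow> 's pmf" and X :: "'s set" and z :: 's and n :: nat
  assumes finite_X: "finite X"
    and closed: "\<And>x. x \<in> X \<Longrightarrow> set_pmf (M x) \<subseteq> X"
    and z: "z \<in> X"
    and n: "n > 0"
    and reach: "\<And>x. x \<in> X \<Longrightarrow> z \<in> set_pmf (state_at M x n)"
begin

lemma pmf_state_at_add:
  assumes "x \<in> X"
  shows "pmf (state_at M x (t + m)) s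
       = (\<Sum>y\<in>X. pmf (state_at M x m) y * pmf (state_at M y t) s)"
  unfolding state_at_add using finite_X set_state_at_subset[OF closed] assms
  by (intro pmf_bind_finite_sum) blast+

lemma sum_pmf_state_at:
  assumes "x \<in> X"
  shows "(\<Sum>y\<in>X. pmf (state_at M x t) y) = 1"
  using finite_X set_state_at_subset[OF closed] assms by (intro sum_pmf_eq_1) blast+

text \<open>Doeblin's minorisation constant, positive because \<open>X\<close> is finite.\<close>

definition reach_prob :: real where
  "reach_prob = Min ((\<lambda>x. pmf (state_at M x n) z) ` X)"

lemma reach_prob_le: "x \<in> X \<Longrightarrow> reach_prob \<le> pmf (state_at M x n) z"
  unfolding reach_prob_def using finite_X by auto

lemma reach_prob_bounds: "0 < reach_prob" "reach_prob \<le> 1"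
proof -
  show "0 < reach_prob"
    unfolding reach_prob_def using finite_X z reach by (subst Min_gr_iff) (auto simp: pmf_positive)
  show "reach_prob \<le> 1"
    using reach_prob_le[OF z] pmf_le_1 by (rule order_trans)
qed

text \<open>Whatever the start, the first \<open>n\<close> steps put mass at least
  \<open>reach_prob\<close> on \<open>z\<close>. All the averages thus share the value at
  \<open>z\<close> with that weight, and their range shrinks by the factor
  \<open>1 - reach_prob\<close>. The offset \<open>r\<close> covers times that are not multiples of
  \<open>n\<close>.\<close>

lemma oscillation_bound:
  "\<exists>lo hi. (\<forall>x\<in>X. lo \<le> pmf (state_at M x (r + k * n)) s \<and> pmf (state_at M x (r + k * n)) s \<le> hi)
     \<and> hi - lo \<le> (1 - reach_prob) ^ k"
proof (induction k)
  case 0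
  show ?case
    by (rule exI[of _ 0], rule exI[of _ 1]) (simp add: pmf_le_1)
next
  case (Suc k)
  define g where "g x = pmf (state_at M x (r + k * n)) s" for x
  from Suc obtain lo hi where lo: "\<And>x. x \<in> X \<Longrightarrow> lo \<le> g x" and hi: "\<And>x. x \<in> X \<Longrightarrow> g x \<le> hi"
    and d: "hi - lo \<le> (1 - reach_prob) ^ k"
    unfolding g_def by blast
  \<comment> \<open>The new bounds give \<open>z\<close> its guaranteed weight and the remaining
    mass the old extreme value; they differ by \<open>(1 - reach_prob) * (hi - lo)\<close>.\<close>
  have "lo + reach_prob * (g z - lo) \<le> pmf (state_at M x (r + Suc k * n)) s
      \<and> pmf (state_at M x (r + Suc k * n)) s \<le> hi - reach_prob * (hi - g z)" if x: "x \<in> X" for x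
  proof -
    define c where "c y = pmf (state_at M x n) y" for y
    have E: "pmf (state_at M x (r + Suc k * n)) s = (\<Sum>y\<in>X. c y * g y)"
      using pmf_state_at_add[OF x, of "r + k * n" n s] by (simp add: g_def c_def algebra_simps)
    have c1: "(\<Sum>y\<in>X. c y) = 1"
      unfolding c_def by (rule sum_pmf_state_at[OF x])
    have cz: "reach_prob \<le> c z"
      unfolding c_def by (rule reach_prob_le[OF x])
    have c0: "0 \<le> c y" for y
      by (simp add: c_def)
    have "reach_prob * (g z - lo) \<le> (\<Sum>y\<in>X. c y * (g y - lo))"
      using finite_X z c0 lo cz by (intro finite_sum_ge_member) auto
    moreover have "reach_prob * (hi - g z) \<le> (\<Sum>y\<in>X. c y * (hi - g y))"
      using finite_X z c0 hi cz by (intro finite_sum_ge_member) auto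
    moreover have "(\<Sum>y\<in>X. c y * (g y - lo)) = (\<Sum>y\<in>X. c y * g y) - lo"
      "(\<Sum>y\<in>X. c y * (hi - g y)) = hi - (\<Sum>y\<in>X. c y * g y)"
      by (simp_all add: right_diff_distrib sum_subtractf c1 flip: sum_distrib_right)
    ultimately show ?thesis
      unfolding E by linarith
  qed
  moreover have "hi - reach_prob * (hi - g z) - (lo + reach_prob * (g z - lo))
      \<le> (1 - reach_prob) ^ Suc k"
    using mult_left_mono[OF d, of "1 - reach_prob"] reach_prob_bounds by (simp add: algebra_simps)
  ultimately show ?case
    by blast
qed

section \<open>Limits from an unnormalised solution of the balance equations\<close>

context
  fixes w :: "'s \<Rightarrow> real"
  assumes w_nonneg: "\<And>x. x \<in> X \<Longrightarrow> 0 \<le> w x"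
    and w_pos: "0 < sum w X"
    and balance: "\<And>y. y \<in> X \<Longrightarrow> (\<Sum>x\<in>X. w x * pmf (M x) y) = w y"
begin

lemma balance_state_at:
  assumes "s \<in> X"
  shows "(\<Sum>x\<in>X. w x * pmf (state_at M x t) s) = w s"
proof (induction t)
  case 0
  have "(\<Sum>x\<in>X. w x * pmf (state_at M x 0) s) = (\<Sum>x\<in>X. if x = s then w x else 0)"
    by (intro sum.cong) (auto simp: pmf_return)
  then show ?case
    using finite_X assms by simp
next
  case (Suc t)
  \<comment> \<open>The first step is split off, so that \<open>balance\<close> can absorb
    it.\<close>
  have "(\<Sum>x\<in>X. w x * pmf (state_at M x (t + 1)) s)
      = (\<Sum>x\<in>X. w x * (\<Sum>y\<in>X. pmf (M x) y * pmf (state_at M y t) s))"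
    by (intro sum.cong refl) (simp only: pmf_state_at_add, simp add: bind_return_pmf)
  also have "\<dots> = (\<Sum>y\<in>X. (\<Sum>x\<in>X. w x * pmf (M x) y) * pmf (state_at M y t) s)"
    unfolding sum_distrib_left sum_distrib_right
    by (subst sum.swap) (simp add: mult.assoc)
  also have "\<dots> = w s"
    using Suc by (simp add: balance)
  finally show ?case
    by simp
qed

lemma state_at_tendsto:
  assumes "s0 \<in> X" "s \<in> X"
  shows "(\<lambda>t. pmf (state_at M s0 t) s) \<longlonglongrightarrow> w s / sum w X"
proof -
  have bound: "\<bar>pmf (state_at M s0 t) s - w s / sum w X\<bar> \<le> (1 - reach_prob) ^ (t div n)" for t
  proof -
    define f where "f x = pmf (state_at M x t) s" for x
    have "t = t mod n + t div n * n"
      by simp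
    then obtain lo hi where lo: "\<And>x. x \<in> X \<Longrightarrow> lo \<le> f x" and hi: "\<And>x. x \<in> X \<Longrightarrow> f x \<le> hi"
      and d: "hi - lo \<le> (1 - reach_prob) ^ (t div n)"
      using oscillation_bound[of "t mod n" "t div n" s] unfolding f_def by metis
    \<comment> \<open>By invariance \<open>w s / sum w X\<close> is the \<open>w\<close>-weighted
      average of the \<open>t\<close>-step probabilities, hence lies between the same
      bounds.\<close>
    have "lo * sum w X \<le> w s" "w s \<le> hi * sum w X"
      unfolding balance_state_at[OF assms(2), of t, symmetric] sum_distrib_left
      using lo hi w_nonneg
      by (auto intro!: sum_mono simp: f_def mult.commute[of _ "w _"] mult_left_mono)
    then have "lo \<le> w s / sum w X" "w s / sum w X \<le> hi"
      using w_pos by (simp_all add: field_simps)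
    then show ?thesis
      using lo[OF assms(1)] hi[OF assms(1)] d unfolding f_def by linarith
  qed
  have "(\<lambda>t. (1 - reach_prob) ^ (t div n)) \<longlonglongrightarrow> 0"
    using reach_prob_bounds
    by (intro filterlim_compose[OF LIMSEQ_realpow_zero filterlim_at_top_div_const_nat] n) auto
  then have "(\<lambda>t. pmf (state_at M s0 t) s - w s / sum w X) \<longlonglongrightarrow> 0"
    by (rule Lim_null_comparison[rotated]) (use bound in auto)
  then show ?thesis
    by (simp add: LIM_zero_iff)
qed

lemma stationary_prob_eq:
  assumes "s \<in> X"
  shows "stationary_prob M X s = w s / sum w X"
  unfolding stationary_prob_def
  \<comment> \<open>\<open>z\<close> makes \<open>X\<close> nonempty; otherwise every real would
    satisfy the condition under \<open>THE\<close>.\<close>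
  using state_at_tendsto[OF _ assms] z by (intro the_equality) (auto intro: LIMSEQ_unique)

end

end

section \<open>The exclusion process with a common exit probability\<close>

lemma integral_indicator_pair:
  "measure_pmf.expectation A (\<lambda>k. indicat_real {(y, v)} (k, u)) = pmf A y * indicator {v} u"
  by (subst integral_measure_pmf[of "{y}"]) (auto simp: indicator_def split: if_splits)

text \<open>\<open>T\<close> is \<open>{1, 2}\<close> for the two-type system and \<open>{1}\<close>
  for the one-type system. It may exceed the support of \<open>A\<close>, as \<open>a 1\<close> or
  \<open>a 2\<close> may be zero.\<close>

locale exclusion_chain =
  fixes \<alpha> b :: real and A :: "nat pmf" and p \<beta> :: "nat \<Rightarrow> real" and T :: "nat set"
  assumes \<alpha>: "0 < \<alpha>" "\<alpha> < 1"
    and b: "0 < b" "b \<le> 1"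
    and T: "finite T" "0 \<notin> T" "set_pmf A \<subseteq> T"
    and p: "\<And>k. k \<in> T \<Longrightarrow> 0 < p k" "\<And>k. k \<in> T \<Longrightarrow> p k \<le> 1"
    and \<beta>: "\<And>k. k \<in> T \<Longrightarrow> \<beta> k = b"
begin

abbreviation "M \<equiv> exclusion_step \<alpha> A p \<beta>"

abbreviation "X \<equiv> insert 0 T \<times> insert 0 T"

section \<open>One-step transition probabilities\<close>

lemma pmf_A_0: "pmf A 0 = 0"
  using T by (auto simp: set_pmf_iff)

lemma sum_pmf_A: "(\<Sum>k\<in>T. pmf A k) = 1"
  using T by (intro sum_pmf_eq_1)

lemma nonzero: "k \<in> T \<Longrightarrow> k \<noteq> 0"
  using T by metis

text \<open>Law of the next content of cell 1 when it is vacant.\<close>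

definition arrival :: "nat \<Rightarrow> real" where
  "arrival y = (if y = 0 then 1 - \<alpha> else \<alpha> * pmf A y)"

text \<open>Law of the next content of cell 2 when it holds type \<open>j\<close>.\<close>

definition departure :: "nat \<Rightarrow> nat \<Rightarrow> real" where
  "departure j y = (if y = 0 then b else if y = j then 1 - b else 0)"

lemma pmf_M_00: "pmf (M (0, 0)) (y1, y2) = (if y2 = 0 then arrival y1 else 0)"
  using \<alpha> pmf_A_0
  by (auto simp: exclusion_step_def arrival_def pmf_bind integral_bernoulli_pmf pmf_return
      bind_return_pmf integral_indicator_pair)

lemma pmf_M_k0:
  "k \<in> T \<Longrightarrow> pmf (M (k, 0)) (y1, y2)
    = (if y1 = 0 \<and> y2 = k then p k else if y1 = k \<and> y2 = 0 then 1 - p k else 0)"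
  using nonzero[of k] p[of k]
  by (auto simp: exclusion_step_def pmf_bind pmf_return)

lemma pmf_M_0j: "j \<in> T \<Longrightarrow> pmf (M (0, j)) (y1, y2) = arrival y1 * departure j y2"
  using \<alpha> b \<beta>[of j] nonzero[of j] pmf_A_0
  by (auto simp: exclusion_step_def arrival_def departure_def pmf_bind pmf_return
      integral_indicator_pair)

lemma pmf_M_kj:
  "k \<in> T \<Longrightarrow> j \<in> T \<Longrightarrow> pmf (M (k, j)) (y1, y2) = (if y1 = k then departure j y2 else 0)"
  using nonzero[of k] nonzero[of j] \<beta>[of j] b
  by (auto simp: exclusion_step_def departure_def pmf_bind pmf_return)

lemma set_M_subset:
  assumes "x \<in> X"
  shows "set_pmf (M x) \<subseteq> X"
  using assms T by (auto simp: exclusion_step_def split: if_splits)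

text \<open>The longest path is \<open>(k, j)\<close>, \<open>(k, 0)\<close>, \<open>(0, k)\<close>,
  \<open>(0, 0)\<close>. Shorter ones are padded by waiting in the empty state, which is possible as
  \<open>\<alpha> < 1\<close>.\<close>

lemma reach_empty:
  assumes "x \<in> X"
  shows "(0, 0) \<in> set_pmf (state_at M x 3)"
proof -
  note [simp] = arrival_def departure_def
  have stay: "(0, 0) \<in> set_pmf (M (0, 0))"
    using \<alpha> by (simp add: set_pmf_iff pmf_M_00)
  have exit: "(0, 0) \<in> set_pmf (M (0, j))" if "j \<in> T" for j
    using that \<alpha> b by (simp add: set_pmf_iff pmf_M_0j)
  have move: "(0, k) \<in> set_pmf (M (k, 0))" if "k \<in> T" for k
    using that p[of k] by (simp add: set_pmf_iff pmf_M_k0)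
  have exit': "(k, 0) \<in> set_pmf (M (k, j))" if "k \<in> T" "j \<in> T" for k j
    using that b by (simp add: set_pmf_iff pmf_M_kj)
  have "\<exists>u\<in>set_pmf (M x). \<exists>v\<in>set_pmf (M u). (0, 0) \<in> set_pmf (M v)"
    using assms stay exit move exit' by (auto; metis)
  then show ?thesis
    by (auto simp: eval_nat_numeral bind_return_pmf)
qed

sublocale doeblin_chain M X "(0, 0)" 3
  using T set_M_subset reach_empty by unfold_locales auto

section \<open>Explicit solution of the balance equations\<close>

definition active :: real where
  "active = 1 - (1 - \<alpha>) * (1 - b)"

lemma active_pos: "0 < active"
proof -
  have "active = \<alpha> * (1 - b) + b"
    by (simp add: active_def algebra_simps)
  then show ?thesis
    using \<alpha> b by (simp add: add_nonneg_pos)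
qed

text \<open>Scaled so that the flow from cell 1 to cell 2 carries type \<open>k\<close> at rate
  \<open>pmf A k\<close>, in total 1. This fixes \<open>(k, 0)\<close>, left with probability
  \<open>p k\<close>, and \<open>(0, k)\<close>, left with probability \<open>active\<close>;
  equating inflow and outflow then gives \<open>(k, j)\<close> and \<open>(0, 0)\<close>.\<close>

definition weight :: "nat \<times> nat \<Rightarrow> real" where
  "weight = (\<lambda>(x1, x2).
     if x1 = 0 then if x2 = 0 then (1 - \<alpha>) * b / (\<alpha> * active) else pmf A x2 / active
     else if x2 = 0 then pmf A x1 / p x1
     else \<alpha> * (1 - b) * pmf A x1 * pmf A x2 / (b * active))"

lemma weight_nonneg:
  assumes "x \<in> X"
  shows "0 \<le> weight x"
  using assms \<alpha> b p active_pos by (auto simp: weight_def less_imp_le)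

lemma sum_weight_pos: "0 < sum weight X"
proof (rule sum_pos2)
  show "0 < weight (0, 0)"
    using \<alpha> b active_pos by (simp add: weight_def)
qed (use T weight_nonneg in auto)

lemma sum_X:
  "(\<Sum>x\<in>X. f x) = f (0, 0) + (\<Sum>j\<in>T. f (0, j)) + (\<Sum>k\<in>T. f (k, 0)) + (\<Sum>k\<in>T. \<Sum>j\<in>T. f (k, j))"
  for f :: "nat \<times> nat \<Rightarrow> real"
proof -
  have "(\<Sum>x\<in>X. f x) = (\<Sum>k\<in>insert 0 T. \<Sum>j\<in>insert 0 T. f (k, j))"
    by (simp only: sum.cartesian_product case_prod_eta)
  then show ?thesis
    using T by (simp add: sum.distrib)
qed

text \<open>With a common exit probability, a particle of \<open>A\<close>-distributed type that
  stays keeps this law. The weights of \<open>(0, j)\<close> and \<open>(k, j)\<close> are both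
  proportional to \<open>pmf A j\<close>, so this sum serves both.\<close>

lemma sum_departure:
  assumes "y \<in> insert 0 T"
  shows "(\<Sum>j\<in>T. pmf A j * departure j y) = (if y = 0 then b else pmf A y * (1 - b))"
proof (cases "y = 0")
  case True
  then show ?thesis
    by (simp add: departure_def sum_pmf_A flip: sum_distrib_right)
next
  case False
  then have "(\<Sum>j\<in>T. pmf A j * departure j y) = (\<Sum>j\<in>T. if y = j then pmf A j * (1 - b) else 0)"
    by (intro sum.cong) (auto simp: departure_def)
  then show ?thesis
    using False assms T by simp
qed

lemma weight_balance:
  assumes "y \<in> X"
  shows "(\<Sum>x\<in>X. weight x * pmf (M x) y) = weight y"
proof -
  obtain y1 y2 where y: "y = (y1, y2)" "y1 \<in> insert 0 T" "y2 \<in> insert 0 T"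
    using assms by auto
  define d where "d = (if y2 = 0 then b else pmf A y2 * (1 - b))"
  have S0: "(\<Sum>j\<in>T. weight (0, j) * pmf (M (0, j)) y) = arrival y1 / active * d"
    unfolding d_def sum_departure[OF y(3), symmetric] sum_distrib_left
    by (intro sum.cong) (auto simp: weight_def y pmf_M_0j nonzero)
  \<comment> \<open>The particle either moves (\<open>k = y2\<close>), where \<open>p k\<close>
    cancels against the weight, or stays (\<open>k = y1\<close>).\<close>
  have "(\<Sum>k\<in>T. weight (k, 0) * pmf (M (k, 0)) y)
      = (\<Sum>k\<in>T. if k = y2 then if y1 = 0 then pmf A k else 0 else 0)
      + (\<Sum>k\<in>T. if k = y1 then if y2 = 0 then pmf A k / p k - pmf A k else 0 else 0)"
    unfolding sum.distrib[symmetric]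
  proof (intro sum.cong refl)
    fix k assume "k \<in> T"
    then show "weight (k, 0) * pmf (M (k, 0)) y
      = (if k = y2 then if y1 = 0 then pmf A k else 0 else 0)
      + (if k = y1 then if y2 = 0 then pmf A k / p k - pmf A k else 0 else 0)"
      using p(1)[of k] nonzero[of k] by (auto simp: weight_def y pmf_M_k0 field_simps)
  qed
  then have S1: "(\<Sum>k\<in>T. weight (k, 0) * pmf (M (k, 0)) y)
      = (if y1 = 0 \<and> y2 \<noteq> 0 then pmf A y2
         else if y1 \<noteq> 0 \<and> y2 = 0 then pmf A y1 / p y1 - pmf A y1 else 0)"
    using T y by auto
  have "(\<Sum>j\<in>T. weight (k, j) * pmf (M (k, j)) y)
      = (if k = y1 then \<alpha> * (1 - b) * pmf A k / (b * active) * d else 0)" if "k \<in> T" for k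
    using that
    unfolding d_def sum_departure[OF y(3), symmetric] sum_distrib_left
    by (auto simp: weight_def y pmf_M_kj nonzero intro!: sum.cong sum.neutral)
  then have S2: "(\<Sum>k\<in>T. \<Sum>j\<in>T. weight (k, j) * pmf (M (k, j)) y)
      = (if y1 = 0 then 0 else \<alpha> * (1 - b) * pmf A y1 / (b * active) * d)"
    using T y by auto
  have "active \<noteq> 0" "\<alpha> \<noteq> 0" "b \<noteq> 0"
    using active_pos \<alpha> b by auto
  then show ?thesis
    unfolding sum_X S0 S1 S2
    by (auto simp: y weight_def pmf_M_00 arrival_def d_def divide_simps)
      (simp_all add: active_def algebra_simps)
qed

lemma stationary_prob_M:
  assumes "x \<in> X"
  shows "stationary_prob M X x = weight x / sum weight X"
  using weight_nonneg sum_weight_pos weight_balance assms by (rule stationary_prob_eq)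

end

section \<open>Lumping the particle types\<close>

theorem theorem3:
  fixes \<alpha> b :: real and a p \<beta> :: "nat \<Rightarrow> real" and y1 y2 :: nat
  assumes "0 < \<alpha>" "\<alpha> < 1"
    and "0 < p 1" "p 1 < 1" "0 < p 2" "p 2 < 1"
    and "0 < b" "b < 1" "\<beta> 1 = b" "\<beta> 2 = b"
    and "a 1 \<ge> 0" "a 2 \<ge> 0" "a 1 + a 2 = 1"
    and "y1 \<in> {0, 1}" "y2 \<in> {0, 1}"
  shows "(\<Sum>x\<in>G y1 y2. stationary_prob (S_step \<alpha> a p \<beta>) S_states x)
       = stationary_prob (Sstar_step \<alpha> a p \<beta>) Sstar_states (y1, y2)"
proof -
  have a1: "a 1 \<le> 1" and a2: "a 2 = 1 - a 1"
    using assms by auto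
  \<comment> \<open>Makes \<open>star_prob a p\<close>, a weighted harmonic mean of
    \<open>p 1\<close> and \<open>p 2\<close>, positive and at most 1.\<close>
  have "a 1 + a 2 \<le> a 1 / p 1 + a 2 / p 2"
    using assms by (intro add_mono) (simp_all add: pos_le_divide_eq mult_left_le)
  then have p': "1 \<le> a 1 / p 1 + a 2 / p 2"
    using assms by simp
  have star_p: "1 / star_prob a p = a 1 / p 1 + a 2 / p 2"
    by (simp add: star_prob_def inverse_eq_divide)
  have \<beta>': "star_prob a \<beta> = b"
    using assms by (simp add: star_prob_def flip: add_divide_distrib)
  have A: "pmf (type_pmf a) 1 = a 1" "pmf (type_pmf a) 2 = a 2" "set_pmf (type_pmf a) \<subseteq> {1, 2}"
    using assms a1 a2 by (auto simp: type_pmf_def map_pmf_def pmf_bind pmf_return)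
  interpret S: exclusion_chain \<alpha> b "type_pmf a" p \<beta> "{1, 2}"
    using assms A by unfold_locales auto
  interpret Sstar: exclusion_chain \<alpha> b "return_pmf 1"
    "\<lambda>_. star_prob a p" "\<lambda>_. star_prob a \<beta>" "{1}"
    using assms \<beta>' p' by unfold_locales (auto simp: star_prob_def inverse_le_1_iff)
  have G: "G 0 0 = {(0, 0)}" "G 0 1 = {(0, 1), (0, 2)}" "G 1 0 = {(1, 0), (2, 0)}"
    "G 1 1 = {(1, 1), (1, 2), (2, 1), (2, 2)}"
    by (auto simp: G_def S_states_def eta_def split: if_splits)
  \<comment> \<open>The weights agree before normalisation: the type probabilities sum to 1, and on
    \<open>G 1 0\<close> the sum is \<open>1 / star_prob a p\<close>.\<close>
  have lump: "sum S.weight (G z1 z2) = Sstar.weight (z1, z2)"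
    if "z1 \<in> {0, 1}" "z2 \<in> {0, 1}" for z1 z2
    using that a2 star_p
    by (auto simp: S.weight_def Sstar.weight_def G A add_divide_distrib[symmetric]
        simp del: One_nat_def)
      (simp_all add: algebra_simps)
  \<comment> \<open>The four sets partition the state space, so the normalising constants agree
    too.\<close>
  have "sum S.weight S.X = sum S.weight (G 0 0) + sum S.weight (G 0 1)
      + sum S.weight (G 1 0) + sum S.weight (G 1 1)"
    unfolding S.sum_X by (simp add: G del: One_nat_def)
  also have "\<dots> = sum Sstar.weight Sstar.X"
    unfolding Sstar.sum_X by (simp add: lump del: One_nat_def)
  finally have total: "sum S.weight S.X = sum Sstar.weight Sstar.X" .
  have "(\<Sum>x\<in>G y1 y2. stationary_prob (S_step \<alpha> a p \<beta>) S_states x)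
      = (\<Sum>x\<in>G y1 y2. S.weight x / sum S.weight S.X)"
    using S.stationary_prob_M
    by (intro sum.cong) (auto simp: S_step_def S_states_def G_def)
  also have "\<dots> = Sstar.weight (y1, y2) / sum Sstar.weight Sstar.X"
    using assms by (simp only: lump total flip: sum_divide_distrib)
  also have "\<dots> = stationary_prob (Sstar_step \<alpha> a p \<beta>) Sstar_states (y1, y2)"
    unfolding Sstar_step_def Sstar_states_def
    using assms by (intro Sstar.stationary_prob_M[symmetric]) auto
  finally show ?thesis .
qed

end
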